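(* For every integer $n>0$, $s_{c'}(n)-2s_e(n)$ equals the weighted number of partitions of $n$ into even parts in which exactly one part size occurs more than once, where such a partition is counted with weight $1$ if its repeated part is its smallest part and with weight $2$ otherwise.
   Context: For a partition $\lambda$ with conjugate $\lambda'$ (cells $(i,j)$ = row $i$, column $j$ of the Young diagram; $\lambda_i=0$ beyond the length), the symplectic content of a cell is $c^\lambda_{sp}(i,j)=\lambda_i+\lambda_j-i-j+2$ if $i>j$ and $c^\lambda_{sp}(i,j)=i+j-\lambda'_i-\lambda'_j$ if $i\le j$. $s_{c'}(n)$ is the total number of parts of all partitions $\lambda$ of $n$ with $c^\lambda_{sp}(u)\ne0$ for all cells $u\in\lambda$; $s_e(n)$ is the total number of parts of all partitions of $n$ into distinct even parts. *)

theory Defs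
  imports Main
begin

text \<open>An integer partition is the weakly decreasing list of its (positive) parts; rows, columns
  and cells are indexed from 1.\<close>

definition partitions :: "nat \<Rightarrow> nat list set" where
  "partitions n = {lam. sorted_wrt (\<ge>) lam \<and> (\<forall>x\<in>set lam. 0 < x) \<and> sum_list lam = n}"

definition part :: "nat list \<Rightarrow> nat \<Rightarrow> nat" where
  "part lam i = (if 1 \<le> i \<and> i \<le> length lam then lam ! (i - 1) else 0)"

definition conj_part :: "nat list \<Rightarrow> nat \<Rightarrow> nat" where
  "conj_part lam j = card {i \<in> {1..length lam}. j \<le> part lam i}"

definition cells :: "nat list \<Rightarrow> (nat \<times> nat) set" where
  "cells lam = {(i, j). 1 \<le> i \<and> i \<le> length lam \<and> 1 \<le> j \<and> j \<le> part lam i}"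

definition sp_content :: "nat list \<Rightarrow> nat \<Rightarrow> nat \<Rightarrow> int" where
  "sp_content lam i j =
     (if i > j then int (part lam i) + int (part lam j) - int i - int j + 2
      else int i + int j - int (conj_part lam i) - int (conj_part lam j))"

definition s_c' :: "nat \<Rightarrow> nat" where
  "s_c' n = (\<Sum>lam\<in>{lam \<in> partitions n. \<forall>(i, j)\<in>cells lam. sp_content lam i j \<noteq> 0}. length lam)"

definition s_e :: "nat \<Rightarrow> nat" where
  "s_e n = (\<Sum>lam\<in>{lam \<in> partitions n. distinct lam \<and> (\<forall>x\<in>set lam. even x)}. length lam)"

definition one_repeated_even_partitions :: "nat \<Rightarrow> nat list set" where
  "one_repeated_even_partitions n =
     {lam \<in> partitions n. (\<forall>x\<in>set lam. even x) \<and> (\<exists>!x. count_list lam x > 1)}"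

definition repeated_weight :: "nat list \<Rightarrow> nat" where
  "repeated_weight lam = (if (THE x. count_list lam x > 1) = Min (set lam) then 1 else 2)"

text \<open>The sums above range over finite sets.\<close>

lemma finite_partitions: "finite (partitions n)"
proof (rule finite_subset)
  have len: "length xs \<le> sum_list xs" if "\<forall>x\<in>set xs. 0 < x" for xs :: "nat list"
    using that by (induction xs) auto
  show "partitions n \<subseteq> {xs. set xs \<subseteq> {..n} \<and> length xs \<le> n}"
    using len by (auto simp: partitions_def dest: member_le_sum_list)
  show "finite {xs. set xs \<subseteq> {..n} \<and> length xs \<le> n}"
    by (rule finite_lists_length_le) simp
qed

end

theory Submission
  imports "HOL-Library.Multiset" Defs
begin

text \<open>Put \<open>x\<^sub>i = \<lambda>\<^sub>i - i + 1\<close> and \<open>y\<^sub>j = \<lambda>'\<^sub>j - j\<close>. The symplectic contents are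
  \<open>x\<^sub>i + x\<^sub>j\<close> (\<open>i > j\<close>) and \<open>- (y\<^sub>i + y\<^sub>j)\<close> (\<open>i \<le> j\<close>), and every integer is some \<open>x\<^sub>i\<close> or
  some \<open>- y\<^sub>j\<close>. Looking at the last diagonal position with \<open>x\<^sub>i \<noteq> y\<^sub>i\<close> one sees that no
  content vanishes iff \<open>x\<^sub>i = y\<^sub>i\<close> on the whole diagonal. Such partitions of \<open>2N\<close> correspond
  to sets \<open>A\<close> of positive integers with sum \<open>N\<close>, the number of parts being \<open>Max A + 1\<close>.

  It remains to evaluate the sum of \<open>Max A + 1 - 2 |A|\<close> over these \<open>A\<close>. Consider triples
  \<open>(A, r, m)\<close> with \<open>r, m > 0\<close> and \<open>\<Sum>A + m r = N\<close>, and let \<open>t\<^sub>k\<close> count those in which \<open>A\<close> has no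
  element in \<open>(k, k + r]\<close>. The difference of \<open>t\<close> at \<open>k + 1\<close> and \<open>k\<close> is the number of sets having a
  gap at \<open>k + 1\<close>, so the total number of gaps (the sum of \<open>Max A - |A|\<close>) is the number of all
  triples minus the number of those with \<open>r\<close> below all of \<open>A\<close>. Triples with \<open>r \<in> A\<close> turn into
  triples with \<open>r \<notin> A\<close> and \<open>m \<ge> 2\<close>, i.e. partitions with exactly one repeated part, and
  triples with \<open>r \<notin> A\<close> and \<open>m = 1\<close> are sets with a chosen element.\<close>

section \<open>Partitions with nonvanishing symplectic contents\<close>

lemma part_antimono:
  assumes "sorted_wrt (\<ge>) lam" "1 \<le> i" "i \<le> k"
  shows "part lam k \<le> part lam i"
  using assms sorted_wrt_nth_less[OF assms(1), of "i - 1" "k - 1"]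
  by (cases "i = k") (auto simp: part_def)

text \<open>The rows reaching column \<open>j\<close> form an initial segment because parts
  decrease, so their number decides which rows they are. Both sides say that \<open>(i, j)\<close>
  is a cell.\<close>

lemma le_part_iff_le_conj_part:
  assumes "sorted_wrt (\<ge>) lam" "1 \<le> i" "1 \<le> j"
  shows "j \<le> part lam i \<longleftrightarrow> i \<le> conj_part lam j"
proof -
  define S where "S = {i \<in> {1..length lam}. j \<le> part lam i}"
  have S: "conj_part lam j = card S" "finite S" by (simp_all add: conj_part_def S_def)
  show ?thesis
  proof
    assume j: "j \<le> part lam i"
    then have "i \<le> length lam" using assms(3) by (auto simp: part_def split: if_splits)
    then have "{1..i} \<subseteq> S"
      using part_antimono[OF assms(1)] j by (fastforce simp: S_def)
    then show "i \<le> conj_part lam j" using card_mono[OF S(2), of "{1..i}"] S(1) by simp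
  next
    assume i: "i \<le> conj_part lam j"
    show "j \<le> part lam i"
    proof (rule ccontr)
      assume "\<not> j \<le> part lam i"
      moreover have "j \<le> part lam i" if "k \<in> S" "i \<le> k" for k
        using part_antimono[OF assms(1,2) that(2)] that(1) by (simp add: S_def)
      ultimately have "S \<subseteq> {1..<i}"
        by (intro subsetI) (fastforce simp: S_def)
      then have "card S \<le> i - 1" using card_mono[of "{1..<i}" S] by simp
      then show False using i S(1) assms(2) by simp
    qed
  qed
qed

lemma conj_part_antimono: "j \<le> k \<Longrightarrow> conj_part lam k \<le> conj_part lam j"
  unfolding conj_part_def by (rule card_mono) auto

text \<open>The border of the diagram is a lattice path with a step for every integer: vertical
  steps carry the values \<open>x\<^sub>k\<close>, horizontal ones the values
  \<open>- y\<^sub>j\<close>. To find the step of \<open>v\<close>, take the first row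
  \<open>k\<close> with \<open>x\<^sub>k \<le> v\<close>; if the inequality is strict,
  \<open>v\<close> belongs to a column of height \<open>k - 1\<close>.\<close>

lemma part_or_conj_part_cover:
  fixes v :: int
  assumes "sorted_wrt (\<ge>) lam"
  shows "(\<exists>k\<ge>1. v = int (part lam k) - int k + 1) \<or> (\<exists>j\<ge>1. v = int j - int (conj_part lam j))"
proof -
  define P where "P k \<longleftrightarrow> 1 \<le> k \<and> int (part lam k) - int k + 1 \<le> v" for k
  define k where "k = (LEAST k. P k)"
  \<comment> \<open>Below the diagram \<open>part\<close> is 0, so a row this far down satisfies
    \<open>P\<close> and a least one exists.\<close>
  have "P (length lam + nat \<bar>v\<bar> + 1)" by (simp add: P_def part_def)
  then have Pk: "P k" and least: "\<And>i. i < k \<Longrightarrow> \<not> P i"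
    unfolding k_def by (auto intro: LeastI dest: not_less_Least)
  show ?thesis
  proof (cases "int (part lam k) - int k + 1 = v")
    case True
    then show ?thesis using Pk by (auto simp: P_def)
  next
    case False
    \<comment> \<open>Solves \<open>v = j - (k - 1)\<close> for the column that must have height
      \<open>k - 1\<close>.\<close>
    define j where "j = nat (v + int k - 1)"
    have lt: "part lam k < j" "int j = v + int k - 1" using False Pk by (auto simp: P_def j_def)
    then have "\<not> k \<le> conj_part lam j"
      using le_part_iff_le_conj_part[OF assms, of k j] Pk by (simp add: P_def)
    moreover have "k - 1 \<le> conj_part lam j"
    proof (cases "k = 1")
      case False
      then have "\<not> P (k - 1)" "1 \<le> k - 1" using least[of "k - 1"] Pk by (auto simp: P_def)
      then have "j \<le> part lam (k - 1)" using lt by (auto simp: P_def)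
      then show ?thesis
        using le_part_iff_le_conj_part[OF assms \<open>1 \<le> k - 1\<close>, of j] lt by simp
    qed simp
    ultimately have "conj_part lam j = k - 1" by linarith
    then have "v = int j - int (conj_part lam j)" using lt Pk by (simp add: P_def)
    then show ?thesis using lt by (metis One_nat_def Suc_leI gr_zeroI not_less0)
  qed
qed

text \<open>In Frobenius coordinates: every leg exceeds the corresponding arm by one.\<close>

definition doubled :: "nat list \<Rightarrow> bool" where
  "doubled lam \<longleftrightarrow> (\<forall>i\<ge>1. i \<le> part lam i \<longrightarrow> conj_part lam i = part lam i + 1)"

text \<open>If \<open>x\<close> and \<open>y\<close> agree on the diagonal, the content of a cell is
  a hook length up to sign, or a sum of two numbers that are not both zero and not positive.
  Conversely, a last diagonal mismatch yields, by \<open>cover\<close>, either a cell with content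
  zero or a later mismatch.\<close>

lemma sp_content_nonzero_iff_doubled:
  assumes sorted: "sorted_wrt (\<ge>) lam"
  shows "(\<forall>(i, j)\<in>cells lam. sp_content lam i j \<noteq> 0) \<longleftrightarrow> doubled lam"
proof -
  have cell: "(i, j) \<in> cells lam \<longleftrightarrow> 1 \<le> i \<and> 1 \<le> j \<and> j \<le> part lam i" for i j
    by (auto simp: cells_def part_def)
  note galois = le_part_iff_le_conj_part[OF sorted]
  define x where "x i = int (part lam i) - int i + 1" for i
  define y where "y j = int (conj_part lam j) - int j" for j
  have x_dec: "x k < x i" if "1 \<le> i" "i < k" for i k
    using part_antimono[OF sorted, of i k] that by (simp add: x_def)
  have y_dec: "y k < y i" if "i < k" for i k
    using conj_part_antimono[of i k lam] that by (simp add: y_def)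
  have x_lessD: "i < k" if "x k < x i" "1 \<le> k" for i k
    using that x_dec[of k i] by (cases "k = i"; cases "k < i") auto
  have y_lessD: "i < k" if "y k < y i" for i k
    using that y_dec[of k i] by (cases "k = i"; cases "k < i") auto
  \<comment> \<open>The quantity \<open>x i + y j\<close> is the hook length of a cell
    \<open>(i, j)\<close>; outside the diagram it is negative.\<close>
  have cellI: "j \<le> part lam i" if "x i + y j \<ge> 0" "1 \<le> i" "1 \<le> j" for i j
    using that galois[of i j] by (cases "j \<le> part lam i") (auto simp: x_def y_def)
  have cellD: "x i + y j > 0" if "j \<le> part lam i" "1 \<le> i" "1 \<le> j" for i j
    using that galois[of i j] by (simp add: x_def y_def)
  have content: "sp_content lam i j = (if j < i then x i + x j else - (y i + y j))" for i j
    by (simp add: sp_content_def x_def y_def)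
  have cover: "(\<exists>k\<ge>1. v = x k) \<or> (\<exists>j\<ge>1. v = - y j)" for v
    using part_or_conj_part_cover[OF sorted, of v] by (simp add: x_def y_def)
  have dbl: "doubled lam \<longleftrightarrow> (\<forall>i\<ge>1. x i > 0 \<longrightarrow> x i = y i)"
    by (auto simp: doubled_def x_def y_def)
  show ?thesis
  proof
    assume "doubled lam"
    then have eq: "x i = y i" if "1 \<le> i" "x i > 0" for i using that dbl by blast
    have "sp_content lam i j \<noteq> 0" if "(i, j) \<in> cells lam" for i j
    proof -
      have ij: "1 \<le> i" "1 \<le> j" "x i + y j > 0" using that cell cellD by auto
      show ?thesis
      proof (cases "j < i")
        case True
        show ?thesis
        proof (cases "x j > 0")
          case True
          then show ?thesis using eq[of j] ij \<open>j < i\<close> by (simp add: content)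
        next
          case False
          then have "x i < 0" "y j < 0 \<or> y j \<ge> 0" using x_dec[of j i] ij True by auto
          then show ?thesis using False \<open>j < i\<close> by (simp add: content)
        qed
      next
        case False
        show ?thesis
        proof (cases "x i > 0")
          case True
          then show ?thesis using eq[of i] ij False by (simp add: content)
        next
          case xi: False
          have "j \<le> part lam i" using that cell by auto
          then have "i \<le> part lam i" using False by simp
          then show ?thesis using xi by (simp add: x_def)
        qed
      qed
    qed
    then show "\<forall>(i, j)\<in>cells lam. sp_content lam i j \<noteq> 0" by auto
  next
    assume "\<forall>(i, j)\<in>cells lam. sp_content lam i j \<noteq> 0"
    then have nz: "sp_content lam i j \<noteq> 0" if "j \<le> part lam i" "1 \<le> i" "1 \<le> j" for i j
      using that cell by auto
    have y_pos: "y i > 0" if "1 \<le> i" "x i > 0" for i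
    proof -
      have "i \<le> part lam i" using that by (simp add: x_def)
      \<comment> \<open>The content of \<open>(i, i)\<close> is \<open>- 2 * y i\<close>, which
        rules out \<open>y i = 0\<close>.\<close>
      then have "y i \<noteq> 0" "y i \<ge> 0" using nz[of i i] galois[of i i] that
        by (auto simp: content y_def)
      then show ?thesis by simp
    qed
    have "x i = y i" if i: "1 \<le> i" "x i > 0" for i
    proof (rule ccontr)
      assume ne: "x i \<noteq> y i"
      define B where "B = {i. 1 \<le> i \<and> x i > 0 \<and> x i \<noteq> y i}"
      have "B \<subseteq> {..part lam 1}"
        using part_antimono[OF sorted, of 1] by (fastforce simp: B_def x_def)
      then have "finite B" by (rule finite_subset) simp
      moreover have "i \<in> B" using i ne by (simp add: B_def)
      ultimately have "finite B" "B \<noteq> {}" by auto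
      then have M: "Max B \<in> B" and max: "\<And>k. k \<in> B \<Longrightarrow> k \<le> Max B"
        using Max_in[of B] by auto
      define m where "m = Max B"
      have m: "1 \<le> m" "x m > 0" "x m \<noteq> y m" "y m > 0" using M y_pos by (auto simp: m_def B_def)
      have later: "x k = y k" if "m < k" "x k > 0" for k
        using max[of k] that m(1) by (auto simp: B_def m_def)
      show False
      proof (cases "x m > y m")
        case True
        \<comment> \<open>If \<open>y m = x k\<close>, then \<open>x k > y k\<close> is a later
          mismatch on the diagonal. If \<open>y m = - y j\<close>, then \<open>(m, j)\<close> is a
          cell with content zero.\<close>
        consider k where "1 \<le> k" "y m = x k" | j where "1 \<le> j" "y m = - y j"
          using cover[of "y m"] by blast
        then show False
        proof cases
          case 1
          then have "m < k" using True by (intro x_lessD) simp_all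
          then show False using later[of k] 1 m(4) y_dec[of m k] by simp
        next
          case 2
          then have "m < j" using m(4) by (intro y_lessD) linarith
          moreover have "j \<le> part lam m" using cellI[of m j] True 2 m(1) by simp
          ultimately show False using nz[of j m] m(1) 2 by (simp add: content)
        qed
      next
        case False
        \<comment> \<open>The mirror image: if \<open>x k = - x m\<close>, then
          \<open>(k, m)\<close> is a cell with content zero; if \<open>x m = y j\<close>, then
          \<open>x j < y j\<close> is a later mismatch.\<close>
        consider k where "1 \<le> k" "- x m = x k" | j where "1 \<le> j" "x m = y j"
          using cover[of "- x m"] by force
        then show False
        proof cases
          case 1
          then have "m < k" using m(2) by (intro x_lessD) linarith+
          moreover have "m \<le> part lam k" using cellI[of k m] False 1 m(1) by simp
          ultimately show False using nz[of m k] m(1) 1 by (simp add: content)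
        next
          case 2
          then have "m < j" using False m(3) by (intro y_lessD) linarith
          then have "x j < y j" using x_dec[of m j] m(1) 2 by simp
          moreover have "x j > 0"
          proof (rule ccontr)
            assume "\<not> x j > 0"
            then have "\<not> j \<le> part lam j" by (simp add: x_def)
            then have "y j < 0" using galois[of j j] 2(1) by (simp add: y_def)
            then show False using 2 m(2) by simp
          qed
          ultimately show False using later[of j] \<open>m < j\<close> by simp
        qed
      qed
    qed
    then show "doubled lam" using dbl by blast
  qed
qed

section \<open>Building and peeling partitions hook by hook\<close>

lemma conj_part_eq_length_filter: "conj_part lam j = length (filter (\<lambda>x. j \<le> x) lam)"
proof -
  have "{i \<in> {1..length lam}. j \<le> part lam i} = Suc ` {i. i < length lam \<and> j \<le> lam ! i}"
    by (auto simp: part_def image_iff Suc_le_eq gr0_conv_Suc)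
  then show ?thesis by (simp add: conj_part_def length_filter_conv_card card_image)
qed

text \<open>The partition with Frobenius arms \<open>a - 1\<close> and legs \<open>a\<close>, for \<open>a\<close> running through the given
  strictly decreasing list.\<close>

fun double :: "nat list \<Rightarrow> nat list" where
  "double [] = []"
| "double (a # as) = a # map Suc (double as) @ replicate (a - length (double as)) 1"

definition strict_partitions :: "nat \<Rightarrow> nat list set" where
  "strict_partitions N = {as. sorted_wrt (>) as \<and> 0 \<notin> set as \<and> sum_list as = N}"

lemma part_Cons: "part (a # t) i = (if i = 1 then a else part t (i - 1))"
  by (auto simp: part_def nth_Cons' )

text \<open>The subtraction in \<open>double\<close> does not truncate: the tail starts with some
  \<open>b < a\<close>, so its image has \<open>b + 1 \<le> a\<close> parts.\<close>

lemma length_double: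
  assumes "sorted_wrt (>) (a # as)"
  shows "length (double (a # as)) = Suc a"
  using assms
proof (induction as arbitrary: a)
  case (Cons b as)
  then show ?case by (auto simp del: double.simps(2) simp: double.simps(2)[of a "b # as"])
qed simp

lemma sum_list_map_Suc: "sum_list (map Suc xs) = sum_list xs + length xs"
  by (induction xs) auto

lemma length_double_le:
  assumes "sorted_wrt (>) (a # as)"
  shows "length (double as) \<le> a"
  using assms length_double by (cases as) (auto simp del: double.simps(2))

lemma sum_list_double:
  "sorted_wrt (>) as \<Longrightarrow> sum_list (double as) = 2 * sum_list as"
proof (induction as)
  case (Cons a as)
  then show ?case using length_double_le[OF Cons.prems]
    by (simp add: sum_list_map_Suc sum_list_replicate)
qed simp

lemma sorted_wrt_ge_replicate: "sorted_wrt (\<ge>) (replicate k (a :: nat))"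
  by (induction k) auto

text \<open>The bound by \<open>hd as\<close> strengthens the induction: all inner parts lie
  strictly below the new first part, so they may be raised by one. For the empty list the bound is
  vacuous.\<close>

lemma double_partition:
  "sorted_wrt (>) as \<Longrightarrow> 0 \<notin> set as \<Longrightarrow>
    sorted_wrt (\<ge>) (double as) \<and> 0 \<notin> set (double as) \<and> (\<forall>x\<in>set (double as). \<forall>a\<in>{hd as}. x \<le> a)"
proof (induction as)
  case (Cons a as)
  have "x < a" if "x \<in> set (double as)" for x
    using Cons that by (cases as) (auto simp del: double.simps(2))
  with Cons show ?case
    by (auto simp: sorted_wrt_append sorted_wrt_map less_Suc_eq_le Suc_le_eq sorted_wrt_ge_replicate)
qed simp

text \<open>Removing the first row and column lowers all further diagonal arms and legs alike, so
  the only new condition is the one at the first diagonal cell, where the leg is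
  \<open>length l + k\<close>.\<close>

lemma doubled_Cons_iff:
  assumes lt: "\<forall>x\<in>set l. 0 < x \<and> x < a" and "0 < a"
  shows "doubled (a # map Suc l @ replicate k 1) \<longleftrightarrow> length l + k = a \<and> doubled l"
proof -
  let ?lam = "a # map Suc l @ replicate k 1"
  have part_l: "part l i < a" for i
    using lt assms(2) by (auto simp: part_def)
  have p1: "part ?lam 1 = a" by (simp add: part_Cons)
  have c1: "conj_part ?lam 1 = Suc (length l + k)"
    using assms by (auto simp: conj_part_eq_length_filter o_def)
  have p: "Suc i \<le> part ?lam (Suc i) \<longleftrightarrow> i \<le> part l i" if "1 \<le> i" for i
    using that by (auto simp: part_Cons part_def nth_append)
  have p': "part ?lam (Suc i) = Suc (part l i)" if "1 \<le> i" "i \<le> part l i" for i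
    using that by (auto simp: part_Cons part_def nth_append)
  \<comment> \<open>Since \<open>i \<le> part l i < a\<close>, the first row meets column
    \<open>Suc i\<close>; the trailing ones do not.\<close>
  have c: "conj_part ?lam (Suc i) = Suc (conj_part l i)" if "1 \<le> i" "i \<le> part l i" for i
    using that part_l[of i] by (auto simp: conj_part_eq_length_filter o_def filter_map)
  have split: "(\<forall>i\<ge>1. Q i) \<longleftrightarrow> Q 1 \<and> (\<forall>i\<ge>1. Q (Suc i))" for Q :: "nat \<Rightarrow> bool"
  proof (intro iffI allI impI)
    fix i :: nat assume "Q 1 \<and> (\<forall>i\<ge>1. Q (Suc i))" "1 \<le> i"
    then show "Q i" by (cases "i = 1"; cases i) auto
  qed auto
  have "doubled ?lam \<longleftrightarrow> conj_part ?lam 1 = part ?lam 1 + 1 \<and>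
      (\<forall>i\<ge>1. Suc i \<le> part ?lam (Suc i) \<longrightarrow> conj_part ?lam (Suc i) = part ?lam (Suc i) + 1)"
    unfolding doubled_def using p1 assms(2) by (subst split) simp
  then show ?thesis unfolding p1 c1 using p p' c by (auto simp: doubled_def)
qed

lemma doubled_double: "sorted_wrt (>) as \<Longrightarrow> 0 \<notin> set as \<Longrightarrow> doubled (double as)"
proof (induction as)
  case Nil
  then show ?case by (simp add: doubled_def part_def)
next
  case (Cons a as)
  have "\<forall>x\<in>set (double as). 0 < x \<and> x < a"
    using Cons.prems double_partition[of as] by (cases as) (auto simp del: double.simps(2) intro: gr0I)
  then show ?case
    using Cons length_double_le[of a as] doubled_Cons_iff[of "double as" a] by auto
qed

lemma split_ones:
  assumes "sorted_wrt (\<ge>) t" "0 \<notin> set t"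
  shows "\<exists>l k. t = map Suc l @ replicate k 1 \<and> sorted_wrt (\<ge>) l \<and> 0 \<notin> set l"
  using assms
proof (induction t)
  case (Cons b t)
  then obtain l k where t: "t = map Suc l @ replicate k 1" "sorted_wrt (\<ge>) l" "0 \<notin> set l" by auto
  show ?case
  proof (cases "b = 1")
    case True
    then have "l = []" using Cons.prems t by (cases l) auto
    then have "b # t = map Suc [] @ replicate (Suc k) 1" using True t by simp
    then show ?thesis by (metis empty_iff list.set(1) sorted_wrt.simps(1))
  next
    case False
    then have "b # t = map Suc ((b - 1) # l) @ replicate k 1" "sorted_wrt (\<ge>) ((b - 1) # l)"
      "0 \<notin> set ((b - 1) # l)"
      using Cons.prems t by (auto simp: Suc_le_eq ball_Un)
    then show ?thesis by blast
  qed
qed (auto intro!: exI[of _ "[]"])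

text \<open>Peels off the outer hook: \<open>split_ones\<close> strips the first column from the
  remaining rows, and \<open>doubled_Cons_iff\<close> makes the inner partition doubled
  again.\<close>

lemma doubled_imp_double:
  "sorted_wrt (\<ge>) lam \<Longrightarrow> 0 \<notin> set lam \<Longrightarrow> doubled lam \<Longrightarrow>
    \<exists>as. sorted_wrt (>) as \<and> 0 \<notin> set as \<and> lam = double as"
proof (induction "length lam" arbitrary: lam rule: less_induct)
  case less
  show ?case
  proof (cases lam)
    case Nil
    then show ?thesis by (auto intro!: exI[of _ "[]"])
  next
    case (Cons a t)
    with less.prems obtain l k where t: "t = map Suc l @ replicate k 1" "sorted_wrt (\<ge>) l" "0 \<notin> set l"
      using split_ones[of t] by auto
    have lt: "\<forall>x\<in>set l. 0 < x \<and> x < a" and "0 < a"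
      using less.prems t Cons by (auto simp: Suc_le_eq ball_Un intro: gr0I)
    then have k: "length l + k = a" "doubled l"
      using doubled_Cons_iff less.prems(3) t(1) Cons by blast+
    moreover have "length l < length lam" using Cons t by simp
    ultimately obtain as where as: "sorted_wrt (>) as" "0 \<notin> set as" "l = double as"
      using less.hyps t by blast
    have "sorted_wrt (>) (a # as)"
    proof (cases as)
      case (Cons b bs)
      then have "b < a" using lt as by simp
      then show ?thesis using as Cons by auto
    qed simp
    moreover have "lam = double (a # as)" using k(1) as(3) t(1) Cons by auto
    ultimately show ?thesis using as \<open>0 < a\<close> by (intro exI[of _ "a # as"]) auto
  qed
qed

lemma double_inj:
  "sorted_wrt (>) as \<Longrightarrow> 0 \<notin> set as \<Longrightarrow> sorted_wrt (>) bs \<Longrightarrow> 0 \<notin> set bs \<Longrightarrow>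
    double as = double bs \<Longrightarrow> as = bs"
proof (induction as arbitrary: bs)
  case Nil
  then show ?case by (cases bs) auto
next
  case (Cons a as)
  then obtain b bs' where bs: "bs = b # bs'" by (cases bs) auto
  \<comment> \<open>The parts above 1 after the first row are exactly the raised inner parts, so the
    inner list can be recovered.\<close>
  have f: "filter (\<lambda>x. 1 < x) (map Suc l @ replicate k 1) = map Suc l" if "0 \<notin> set l" for l k
    using that by (auto simp: filter_map o_def intro!: filter_True gr0I)
  have "a = b" "map Suc (double as) @ replicate (a - length (double as)) 1 =
      map Suc (double bs') @ replicate (b - length (double bs')) 1"
    using Cons.prems(5) bs by auto
  moreover have "0 \<notin> set (double as)" "0 \<notin> set (double bs')"
    using Cons.prems bs double_partition by auto
  ultimately have "map Suc (double as) = map Suc (double bs')" using f by metis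
  then have "double as = double bs'" by (simp add: inj_map_eq_map)
  then show ?case using Cons bs \<open>a = b\<close> by auto
qed

text \<open>The weight condition \<open>2 * sum_list as = n\<close> covers odd \<open>n\<close> too:
  then both sets are empty.\<close>

lemma bij_betw_double:
  "bij_betw double {as. sorted_wrt (>) as \<and> 0 \<notin> set as \<and> 2 * sum_list as = n}
    {lam \<in> partitions n. \<forall>(i, j)\<in>cells lam. sp_content lam i j \<noteq> 0}"
  (is "bij_betw _ ?S ?T")
proof (rule bij_betw_imageI)
  show "inj_on double ?S" using double_inj by (auto simp: inj_on_def)
  have T: "?T = {lam. sorted_wrt (\<ge>) lam \<and> 0 \<notin> set lam \<and> sum_list lam = n \<and> doubled lam}"
    using sp_content_nonzero_iff_doubled by (auto simp: partitions_def intro: gr0I)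
  show "double ` ?S = ?T"
  proof (intro equalityI subsetI)
    fix lam assume "lam \<in> ?T"
    then have lam: "sorted_wrt (\<ge>) lam" "0 \<notin> set lam" "sum_list lam = n" "doubled lam"
      unfolding T by auto
    then obtain as where "sorted_wrt (>) as" "0 \<notin> set as" "lam = double as"
      using doubled_imp_double by blast
    then show "lam \<in> double ` ?S" using lam(3) sum_list_double by auto
  qed (auto simp: T double_partition doubled_double sum_list_double)
qed

section \<open>Sets with a marked repeated part\<close>

definition distinct_parts :: "nat \<Rightarrow> nat set set" where
  "distinct_parts N = {A. finite A \<and> 0 \<notin> A \<and> \<Sum>A = N}"

text \<open>A set of distinct parts together with \<open>m\<close> further copies of
  \<open>r\<close>. The value \<open>r\<close> may also lie in \<open>A\<close>, and then occurs
  \<open>m + 1\<close> times in all.\<close>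

definition marked :: "nat \<Rightarrow> (nat set \<times> nat \<times> nat) set" where
  "marked N = {(A, r, m). finite A \<and> 0 \<notin> A \<and> 0 < r \<and> 0 < m \<and> \<Sum>A + m * r = N}"

lemma distinct_parts_subset: "distinct_parts N \<subseteq> Pow {1..N}"
proof
  fix A assume A: "A \<in> distinct_parts N"
  have "a \<in> {1..N}" if "a \<in> A" for a
    using A that member_le_sum[of a A "\<lambda>x. x"]
    by (cases "a = 0") (auto simp: distinct_parts_def)
  then show "A \<in> Pow {1..N}" by auto
qed

lemma finite_distinct_parts: "finite (distinct_parts N)"
  using distinct_parts_subset by (rule finite_subset) simp

lemma marked_subset: "marked N \<subseteq> Pow {1..N} \<times> {1..N} \<times> {1..N}"
proof
  fix p assume p: "p \<in> marked N"
  obtain A r m where [simp]: "p = (A, r, m)" by (metis prod_cases3)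
  have "A \<in> distinct_parts (\<Sum>A)" using p by (auto simp: marked_def distinct_parts_def)
  then have "A \<subseteq> {1..\<Sum>A}" using distinct_parts_subset by blast
  moreover have "\<Sum>A \<le> N" using p by (auto simp: marked_def)
  moreover have "r \<le> m * r" "m \<le> m * r" "m * r \<le> N" using p by (auto simp: marked_def)
  then have "r \<le> N" "m \<le> N" by linarith+
  ultimately show "p \<in> Pow {1..N} \<times> {1..N} \<times> {1..N}"
    using p by (auto simp: marked_def)
qed

lemma finite_marked: "finite (marked N)"
  using marked_subset by (rule finite_subset) simp

section \<open>Counting gaps with a sliding window\<close>

lemma sum_exchange:
  fixes a b :: nat
  assumes "finite A" "a \<in> A" "b \<notin> A"
  shows "\<Sum>(insert b (A - {a})) + a = \<Sum>A + b"
  using assms by (simp add: sum.remove[of A a "\<lambda>x. x"])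

text \<open>The family counted by \<open>t\<^sub>k\<close>. At \<open>k = 0\<close> the window
  forces \<open>r\<close> below all of \<open>A\<close>; at \<open>k = N\<close> it lies beyond
  every possible element.\<close>

definition avoiding :: "nat \<Rightarrow> nat \<Rightarrow> (nat set \<times> nat \<times> nat) set" where
  "avoiding N k = {(A, r, m) \<in> marked N. A \<inter> {k<..k + r} = {}}"

definition gap_at :: "nat \<Rightarrow> nat \<Rightarrow> nat set set" where
  "gap_at N k = {A \<in> distinct_parts N. k \<notin> A \<and> (\<exists>a\<in>A. k < a)}"

text \<open>Trading the part \<open>k + 1\<close> for \<open>k + 1 + r\<close> and dropping one copy of \<open>r\<close> matches the elements
  of \<open>avoiding N (k + 1)\<close> outside \<open>avoiding N k\<close> with those of \<open>avoiding N k\<close> outside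
  \<open>avoiding N (k + 1)\<close>; the elements with a single copy of \<open>r\<close> are left over and give the gaps.\<close>

lemma card_avoiding_Suc:
  "card (avoiding N (Suc k)) = card (avoiding N k) + card (gap_at N (Suc k))"
proof -
  \<comment> \<open>Moving the window from \<open>k\<close> to \<open>Suc k\<close> frees the
    position \<open>Suc k\<close> and forbids \<open>Suc (k + r)\<close>. \<open>Z\<close> is the
    common part, \<open>X\<close> and \<open>Y\<close> are the two differences.\<close>
  define X where "X = {(A, r, m) \<in> marked N. A \<inter> {Suc k<..Suc k + r} = {} \<and> Suc k \<in> A}"
  define Y where "Y = {(A, r, m) \<in> marked N. A \<inter> {k<..k + r} = {} \<and> Suc (k + r) \<in> A}"
  define Z where "Z = {(A, r, m) \<in> marked N. A \<inter> {k<..Suc (k + r)} = {}}"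
  define X1 where "X1 = {(A, r, m) \<in> X. m = 1}"
  define X2 where "X2 = {(A, r, m) \<in> X. 1 < m}"
  have fin: "finite X" "finite Y" "finite Z" "finite X1" "finite X2"
    unfolding X_def Y_def Z_def X1_def X2_def
    by (auto intro!: finite_subset[OF _ finite_marked[of N]])
  have "avoiding N k = Z \<union> Y"
  proof -
    have "{k<..Suc (k + r)} = insert (Suc (k + r)) {k<..k + r}" for r by auto
    then show ?thesis by (auto simp: avoiding_def Z_def Y_def)
  qed
  moreover have "Z \<inter> Y = {}" by (auto simp: Z_def Y_def)
  ultimately have 1: "card (avoiding N k) = card Z + card Y"
    using fin by (simp add: card_Un_disjoint)
  have "avoiding N (Suc k) = Z \<union> X"
  proof -
    have "{k<..Suc (k + r)} = insert (Suc k) {Suc k<..Suc (k + r)}" for r by auto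
    then show ?thesis by (auto simp: avoiding_def Z_def X_def)
  qed
  moreover have "Z \<inter> X = {}" by (auto simp: Z_def X_def)
  ultimately have 2: "card (avoiding N (Suc k)) = card Z + card X"
    using fin by (simp add: card_Un_disjoint)
  have "X = X1 \<union> X2" by (auto simp: X1_def X2_def X_def marked_def)
  moreover have "X1 \<inter> X2 = {}" by (auto simp: X1_def X2_def)
  ultimately have 3: "card X = card X1 + card X2"
    using fin by (simp add: card_Un_disjoint)
  have 4: "card X2 = card Y"
  proof (rule bij_betw_same_card)
    show "bij_betw (\<lambda>(A, r, m). (insert (Suc k + r) (A - {Suc k}), r, m - 1)) X2 Y"
    proof (rule bij_betw_byWitness[where f' = "\<lambda>(A, r, m). (insert (Suc k) (A - {Suc k + r}), r, m + 1)"],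
        goal_cases)
      case 1
      show ?case by (fastforce simp: X2_def X_def marked_def)
    next
      case 2
      show ?case by (fastforce simp: Y_def marked_def)
    next
      case 3
      show ?case
      proof clarify
        fix A r m assume p: "(A, r, m) \<in> X2"
        have A: "finite A" "0 \<notin> A" "0 < r" "1 < m" "\<Sum>A + m * r = N" "Suc k \<in> A"
          "A \<inter> {Suc k<..Suc k + r} = {}"
          using p by (auto simp: X2_def X_def marked_def)
        have "\<Sum>(insert (Suc k + r) (A - {Suc k})) + Suc k = \<Sum>A + (Suc k + r)"
          using A by (intro sum_exchange) auto
        moreover have "m * r = (m - 1) * r + r" using A(4) by (cases m) auto
        ultimately have "\<Sum>(insert (Suc k + r) (A - {Suc k})) + (m - 1) * r = N"
          using A(5) by linarith
        then show "(insert (Suc k + r) (A - {Suc k}), r, m - 1) \<in> Y"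
          using A by (auto simp: Y_def marked_def disjoint_iff)
      qed
    next
      case 4
      show ?case
      proof clarify
        fix A r m assume p: "(A, r, m) \<in> Y"
        have A: "finite A" "0 \<notin> A" "0 < r" "0 < m" "\<Sum>A + m * r = N" "Suc k + r \<in> A"
          "A \<inter> {k<..k + r} = {}"
          using p by (auto simp: Y_def marked_def)
        have "\<Sum>(insert (Suc k) (A - {Suc k + r})) + (Suc k + r) = \<Sum>A + Suc k"
          using A by (intro sum_exchange) auto
        then have "\<Sum>(insert (Suc k) (A - {Suc k + r})) + (m + 1) * r = N"
          using A(5) by (simp add: algebra_simps)
        then show "(insert (Suc k) (A - {Suc k + r}), r, m + 1) \<in> X2"
          using A by (auto simp: X2_def X_def marked_def disjoint_iff)
      qed
    qed
  qed
  have 5: "card X1 = card (gap_at N (Suc k))"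
  proof (rule bij_betw_same_card)
    \<comment> \<open>After \<open>Suc k\<close> is replaced by \<open>Suc k + r\<close>, the empty
      window makes the latter the next element above the gap, so \<open>r\<close> is recovered as a
      distance.\<close>
    define nxt where "nxt A = (LEAST a. a \<in> A \<and> Suc k < a)" for A
    have nxt: "nxt A \<in> A" "Suc k < nxt A" "\<And>a. a \<in> A \<Longrightarrow> Suc k < a \<Longrightarrow> nxt A \<le> a"
      if "A \<in> gap_at N (Suc k)" for A
      using LeastI_ex[of "\<lambda>a. a \<in> A \<and> Suc k < a"] Least_le[of "\<lambda>a. a \<in> A \<and> Suc k < a"] that
      by (auto simp: nxt_def gap_at_def)
    show "bij_betw (\<lambda>(A, r, m). insert (Suc k + r) (A - {Suc k})) X1 (gap_at N (Suc k))"
    proof (rule bij_betw_byWitness[where f' = "\<lambda>A. (insert (Suc k) (A - {nxt A}), nxt A - Suc k, 1)"],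
        goal_cases)
      case 1
      have "(insert (Suc k) (insert (Suc k + r) (A - {Suc k}) - {nxt (insert (Suc k + r) (A - {Suc k}))}),
            nxt (insert (Suc k + r) (A - {Suc k})) - Suc k, 1) = (A, r, m)"
        if p: "(A, r, m) \<in> X1" for A r m
      proof -
        have A: "0 < r" "m = 1" "Suc k \<in> A" "A \<inter> {Suc k<..Suc k + r} = {}"
          using p by (auto simp: X1_def X_def marked_def)
        have "nxt (insert (Suc k + r) (A - {Suc k})) = Suc k + r"
          unfolding nxt_def
        proof (rule Least_equality)
          show "Suc k + r \<le> y" if "y \<in> insert (Suc k + r) (A - {Suc k}) \<and> Suc k < y" for y
            using that A(4) by (cases "y \<le> Suc k + r") auto
        qed (use A in auto)
        then show ?thesis using A by (auto simp: disjoint_iff)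
      qed
      then show ?case by (intro ballI) (simp only: split_paired_all prod.case)
    next
      case 2
      show ?case using nxt by (fastforce simp: gap_at_def)
    next
      case 3
      show ?case
      proof clarify
        fix A r m assume p: "(A, r, m) \<in> X1"
        have A: "finite A" "0 \<notin> A" "0 < r" "m = 1" "\<Sum>A + r = N" "Suc k \<in> A"
          "A \<inter> {Suc k<..Suc k + r} = {}"
          using p by (auto simp: X1_def X_def marked_def)
        have "\<Sum>(insert (Suc k + r) (A - {Suc k})) + Suc k = \<Sum>A + (Suc k + r)"
          using A by (intro sum_exchange) auto
        then show "insert (Suc k + r) (A - {Suc k}) \<in> gap_at N (Suc k)"
          using A by (auto simp: gap_at_def distinct_parts_def)
      qed
    next
      case 4
      show ?case
      proof clarify
        fix A assume p: "A \<in> gap_at N (Suc k)"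
        have A: "finite A" "0 \<notin> A" "\<Sum>A = N" "Suc k \<notin> A"
          using p by (auto simp: gap_at_def distinct_parts_def)
        have "\<Sum>(insert (Suc k) (A - {nxt A})) + nxt A = \<Sum>A + Suc k"
          using A nxt[OF p] by (intro sum_exchange) auto
        then show "(insert (Suc k) (A - {nxt A}), nxt A - Suc k, 1) \<in> X1"
          using A nxt[OF p] by (force simp: X1_def X_def marked_def disjoint_iff)
      qed
    qed
  qed
  show ?thesis using 1 2 3 4 5 by simp
qed

lemma Max_eq_card_plus_gaps:
  fixes A :: "nat set"
  assumes "finite A" "A \<noteq> {}" "0 \<notin> A"
  shows "Max A = card A + card ({0<..<Max A} - A)"
proof -
  have "{0<..Max A} = A \<union> ({0<..<Max A} - A)"
  proof (intro equalityI subsetI)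
    fix x assume "x \<in> {0<..Max A}"
    then show "x \<in> A \<union> ({0<..<Max A} - A)"
      using Max_in[OF assms(1,2)] by (cases "x = Max A") auto
  next
    fix x assume "x \<in> A \<union> ({0<..<Max A} - A)"
    then show "x \<in> {0<..Max A}" using assms by (cases "x = 0") auto
  qed
  then have "card {0<..Max A} = card A + card ({0<..<Max A} - A)"
    using assms by (metis Diff_disjoint card_Un_disjoint finite_Diff finite_greaterThanLessThan)
  then show ?thesis by simp
qed

text \<open>Double counting of pairs of a set and one of its gaps; \<open>k < N\<close> reaches
  every gap because \<open>Max A \<le> N\<close>.\<close>

lemma sum_card_gap_at:
  assumes "0 < N"
  shows "(\<Sum>k<N. card (gap_at N (Suc k))) = (\<Sum>A\<in>distinct_parts N. card ({0<..<Max A} - A))"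
proof -
  have "card (gap_at N (Suc k)) =
      (\<Sum>A\<in>distinct_parts N. if Suc k \<notin> A \<and> (\<exists>a\<in>A. Suc k < a) then 1 else 0)" for k
    using finite_distinct_parts[of N] by (simp add: gap_at_def sum.If_cases Int_def)
  then have "(\<Sum>k<N. card (gap_at N (Suc k))) =
      (\<Sum>A\<in>distinct_parts N. \<Sum>k<N. if Suc k \<notin> A \<and> (\<exists>a\<in>A. Suc k < a) then 1 else 0)"
    by (simp add: sum.swap[of _ "{..<N}"])
  also have "\<dots> = (\<Sum>A\<in>distinct_parts N. card ({0<..<Max A} - A))"
  proof (rule sum.cong[OF refl])
    fix A assume A: "A \<in> distinct_parts N"
    then have ne: "finite A" "A \<noteq> {}" using assms by (auto simp: distinct_parts_def)
    have "Max A \<le> N" using distinct_parts_subset A Max_in[OF ne] by fastforce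
    moreover have "(\<exists>a\<in>A. Suc k < a) \<longleftrightarrow> Suc k < Max A" for k using ne by (simp add: Max_gr_iff)
    ultimately have "{0<..<Max A} - A = Suc ` ({..<N} \<inter> {k. Suc k \<notin> A \<and> (\<exists>a\<in>A. Suc k < a)})"
      by (auto simp: image_iff gr0_conv_Suc)
    then show "(\<Sum>k<N. if Suc k \<notin> A \<and> (\<exists>a\<in>A. Suc k < a) then 1 else 0) = card ({0<..<Max A} - A)"
      by (simp add: card_image sum.If_cases Int_def)
  qed
  finally show ?thesis .
qed

text \<open>Telescopes \<open>card_avoiding_Suc\<close> from \<open>k = 0\<close> to
  \<open>k = N\<close>.\<close>

lemma card_marked:
  assumes "0 < N"
  shows "card (marked N) = card {(A, r, m) \<in> marked N. \<forall>a\<in>A. r < a} +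
    (\<Sum>A\<in>distinct_parts N. card ({0<..<Max A} - A))"
proof -
  have "card (avoiding N k) = card (avoiding N 0) + (\<Sum>i<k. card (gap_at N (Suc i)))" for k
    by (induction k) (simp_all add: card_avoiding_Suc)
  moreover have "avoiding N N = marked N"
    using marked_subset[of N] by (fastforce simp: avoiding_def)
  moreover have "avoiding N 0 = {(A, r, m) \<in> marked N. \<forall>a\<in>A. r < a}"
  proof -
    have "A \<inter> {0<..r} = {} \<longleftrightarrow> (\<forall>a\<in>A. r < a)" if "0 \<notin> A" for A and r :: nat
      using that by (auto simp: disjoint_iff)
    then show ?thesis by (auto simp: avoiding_def marked_def)
  qed
  ultimately show ?thesis using sum_card_gap_at[OF assms] by metis
qed

section \<open>Sorting the triples by multiplicity and position of the marked part\<close>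

lemma card_marked_mem:
  "card {(A, r, m) \<in> marked N. r \<in> A} = card {(A, r, m) \<in> marked N. r \<notin> A \<and> 1 < m}"
proof (rule bij_betw_same_card)
  show "bij_betw (\<lambda>(A, r, m). (A - {r}, r, m + 1))
      {(A, r, m) \<in> marked N. r \<in> A} {(A, r, m) \<in> marked N. r \<notin> A \<and> 1 < m}"
  proof (rule bij_betw_byWitness[where f' = "\<lambda>(A, r, m). (insert r A, r, m - 1)"], goal_cases)
    case 3
    show ?case
      by (auto simp: marked_def sum.remove[where g = "\<lambda>x. x"])
  next
    case 4
    show ?case
    proof clarify
      fix A r m assume "(A, r, m) \<in> marked N" "r \<notin> A" "1 < m"
      then show "(insert r A, r, m - 1) \<in> marked N \<and> r \<in> insert r A"
        by (cases m) (auto simp: marked_def)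
    qed
  qed auto
qed

lemma card_marked_single:
  "card {(A, r, m) \<in> marked N. r \<notin> A \<and> m = 1} = (\<Sum>A\<in>distinct_parts N. card A)"
proof -
  have "card {(A, r, m) \<in> marked N. r \<notin> A \<and> m = 1} = card (SIGMA A:distinct_parts N. A)"
  proof (rule bij_betw_same_card)
    show "bij_betw (\<lambda>(A, r, m). (insert r A, r))
        {(A, r, m) \<in> marked N. r \<notin> A \<and> m = 1} (SIGMA A:distinct_parts N. A)"
    proof (rule bij_betw_byWitness[where f' = "\<lambda>(A, r). (A - {r}, r, 1)"], goal_cases)
      case 4
      have "(A - {r}, r, 1) \<in> marked N" if "A \<in> distinct_parts N" "r \<in> A" for A r
        using that sum.remove[of A r "\<lambda>x. x"] by (cases "r = 0") (auto simp: marked_def distinct_parts_def)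
      then show ?case by auto
    qed (auto simp: marked_def distinct_parts_def)
  qed
  also have "\<dots> = (\<Sum>A\<in>distinct_parts N. card A)"
    using finite_distinct_parts by (simp add: card_SigmaI distinct_parts_def)
  finally show ?thesis .
qed

text \<open>A marked element below all others is the minimum, so marking it involves no choice;
  \<open>0 < N\<close> excludes the empty set.\<close>

lemma card_marked_single_least:
  assumes "0 < N"
  shows "card {(A, r, m) \<in> marked N. (\<forall>a\<in>A. r < a) \<and> m = 1} = card (distinct_parts N)"
proof (rule bij_betw_same_card)
  have Min: "Min A \<in> A" "Min A > 0" "\<And>a. a \<in> A \<Longrightarrow> a \<noteq> Min A \<Longrightarrow> Min A < a"
    if "A \<in> distinct_parts N" for A
  proof -
    have "finite A" "A \<noteq> {}" "0 \<notin> A" using that assms by (auto simp: distinct_parts_def)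
    then show "Min A \<in> A" "Min A > 0" "\<And>a. a \<in> A \<Longrightarrow> a \<noteq> Min A \<Longrightarrow> Min A < a"
      by (auto simp: le_neq_trans intro: gr0I)
  qed
  show "bij_betw (\<lambda>(A, r, m). insert r A)
      {(A, r, m) \<in> marked N. (\<forall>a\<in>A. r < a) \<and> m = 1} (distinct_parts N)"
  proof (rule bij_betw_byWitness[where f' = "\<lambda>A. (A - {Min A}, Min A, 1)"], goal_cases)
    case 1
    have "(insert r A - {Min (insert r A)}, Min (insert r A), 1) = (A, r, 1)"
      if A: "(A, r, 1) \<in> marked N" "\<forall>a\<in>A. r < a" for A r
    proof -
      have "Min (insert r A) = r"
        using A by (intro Min_eqI) (auto simp: marked_def less_imp_le)
      moreover have "r \<notin> A" using A by auto
      ultimately show ?thesis by simp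
    qed
    then show ?case by fastforce
  next
    case 2
    show ?case using Min by auto
  next
    case 3
    show ?case by (auto simp: marked_def distinct_parts_def sum.insert_if)
  next
    case 4
    show ?case
    proof clarify
      fix A assume A: "A \<in> distinct_parts N"
      show "(A - {Min A}, Min A, 1) \<in> marked N \<and> (\<forall>a\<in>A - {Min A}. Min A < a) \<and> 1 = (1::nat)"
        using A Min[OF A] by (auto simp: marked_def distinct_parts_def sum.remove[where g = "\<lambda>x. x"])
    qed
  qed
qed

lemma sum_Max_distinct_parts:
  assumes "0 < N"
  shows "(\<Sum>A\<in>distinct_parts N. Max A + 1) = 2 * (\<Sum>A\<in>distinct_parts N. card A) +
    (\<Sum>(A, r, m)\<in>{(A, r, m) \<in> marked N. r \<notin> A \<and> 1 < m}. if \<forall>a\<in>A. r < a then 1 else (2::nat))"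
proof -
  define R where "R = {(A, r, m) \<in> marked N. r \<notin> A \<and> 1 < m}"
  define S where "S = {(A, r, m) \<in> marked N. (\<forall>a\<in>A. r < a) \<and> 1 < m}"
  define L where "L = {(A, r, m) \<in> marked N. r \<notin> A \<and> m = 1}"
  define D where "D = {(A, r, m) \<in> marked N. (\<forall>a\<in>A. r < a) \<and> m = 1}"
  define T where "T = {(A, r, m) \<in> marked N. r \<in> A}"
  define U where "U = {(A, r, m) \<in> marked N. \<forall>a\<in>A. r < a}"
  have fin: "finite R" "finite S" "finite L" "finite D" "finite T" "finite U"
    unfolding R_def S_def L_def D_def T_def U_def
    by (auto intro!: finite_subset[OF _ finite_marked[of N]])
  have "(\<Sum>A\<in>distinct_parts N. Max A + 1) =
      (\<Sum>A\<in>distinct_parts N. card A + card ({0<..<Max A} - A) + 1)"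
  proof (rule sum.cong[OF refl])
    fix A assume "A \<in> distinct_parts N"
    then show "Max A + 1 = card A + card ({0<..<Max A} - A) + 1"
      using Max_eq_card_plus_gaps[of A] assms by (cases "A = {}") (auto simp: distinct_parts_def)
  qed
  then have 1: "(\<Sum>A\<in>distinct_parts N. Max A + 1) = (\<Sum>A\<in>distinct_parts N. card A) +
      (\<Sum>A\<in>distinct_parts N. card ({0<..<Max A} - A)) + card (distinct_parts N)"
    by (simp only: sum.distrib) simp
  have "marked N = T \<union> (R \<union> L)" by (auto simp: T_def R_def L_def marked_def)
  moreover have "T \<inter> (R \<union> L) = {}" "R \<inter> L = {}" by (auto simp: T_def R_def L_def)
  ultimately have 2: "card (marked N) = card T + (card R + card L)"
    using fin by (simp add: card_Un_disjoint)
  have "U = S \<union> D" by (auto simp: U_def S_def D_def marked_def)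
  moreover have "S \<inter> D = {}" by (auto simp: S_def D_def)
  ultimately have 3: "card U = card S + card D"
    using fin by (simp add: card_Un_disjoint)
  have SR: "S = R \<inter> {(A, r, m). \<forall>a\<in>A. r < a}" by (auto simp: S_def R_def)
  have "(\<Sum>p\<in>R. case p of (A, r, m) \<Rightarrow> if \<forall>a\<in>A. r < a then 1 else (2::nat)) =
      (\<Sum>p\<in>R. if p \<in> {(A, r, m). \<forall>a\<in>A. r < a} then 1 else 2)"
    by (intro sum.cong refl) (simp add: case_prod_unfold)
  also have "\<dots> = card S + 2 * card (R - S)"
  proof -
    have "R - S = R \<inter> - {(A, r, m). \<forall>a\<in>A. r < a}" using SR by blast
    then show ?thesis using fin(1) by (simp only: SR) (simp add: sum.If_cases)
  qed
  finally have 4: "(\<Sum>(A, r, m)\<in>R. if \<forall>a\<in>A. r < a then 1 else (2::nat)) + card S = 2 * card R"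
    using card_Diff_subset[of S R] card_mono[of R S] fin SR by auto
  \<comment> \<open>Writing \<open>G\<close> for the number of gaps,
    \<open>2 |R| + |L| = |S| + |D| + G\<close>. The left side of the claim is
    \<open>|L| + G + |D|\<close>, hence \<open>2 |L| + (2 |R| - |S|)\<close>, and the bracket is the
    weighted sum over \<open>R\<close>.\<close>
  have "card T = card R" "card L = (\<Sum>A\<in>distinct_parts N. card A)" "card D = card (distinct_parts N)"
    "card (marked N) = card U + (\<Sum>A\<in>distinct_parts N. card ({0<..<Max A} - A))"
    unfolding R_def L_def D_def T_def U_def
    using card_marked_mem card_marked_single card_marked_single_least card_marked assms by auto
  then show ?thesis unfolding R_def[symmetric] using 1 2 3 4 by linarith
qed

section \<open>Partitions as sets\<close>

lemma sum_list_sorted_list_of_set: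
  fixes A :: "nat set"
  assumes "finite A"
  shows "sum_list (sorted_list_of_set A) = \<Sum>A"
  using assms sum_list_distinct_conv_sum_set[of "sorted_list_of_set A" "\<lambda>x. x"] by simp

lemma distinct_if_strictly_decreasing:
  fixes as :: "nat list"
  shows "sorted_wrt (>) as \<Longrightarrow> distinct as"
  by (induction as) auto

lemma set_bij_betw_strict_partitions: "bij_betw set (strict_partitions N) (distinct_parts N)"
proof (rule bij_betw_byWitness[where f' = "\<lambda>A. rev (sorted_list_of_set A)"], goal_cases)
  case 1
  have "rev (sorted_list_of_set (set as)) = as" if "sorted_wrt (>) as" for as :: "nat list"
  proof -
    have "sorted_wrt (<) (rev as)" using that by (simp add: sorted_wrt_rev)
    then have "sorted_list_of_set (set (rev as)) = rev as"
      by (intro sorted_list_of_set.idem_if_sorted_distinct) (simp_all add: strict_sorted_iff)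
    then show ?thesis by simp
  qed
  then show ?case by (simp add: strict_partitions_def)
next
  case 3
  have "\<Sum>(set as) = sum_list as" if "sorted_wrt (>) as" for as :: "nat list"
    using distinct_if_strictly_decreasing[OF that] sum_list_distinct_conv_sum_set[of as "\<lambda>x. x"] by simp
  then show ?case by (auto simp: strict_partitions_def distinct_parts_def)
next
  case 4
  show ?case
    by (auto simp: strict_partitions_def distinct_parts_def sorted_wrt_rev sum_list_rev
        sum_list_sorted_list_of_set)
qed (simp add: distinct_parts_def)

section \<open>Both statistics as sums over sets of distinct parts\<close>

lemma s_c'_eq_sum_length_double:
  "s_c' n = (\<Sum>as | sorted_wrt (>) as \<and> 0 \<notin> set as \<and> 2 * sum_list as = n. length (double as))"
  unfolding s_c'_def by (rule sum.reindex_bij_betw[OF bij_betw_double, symmetric])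

text \<open>The largest part \<open>a\<close> of the strict partition is the leg of the first
  diagonal cell, so there are \<open>a + 1\<close> rows. Positivity of \<open>N\<close> keeps
  \<open>Max\<close> away from the empty set.\<close>

lemma s_c'_eq_sum_Max:
  assumes "0 < N"
  shows "s_c' (2 * N) = (\<Sum>A\<in>distinct_parts N. Max A + 1)"
proof -
  have "s_c' (2 * N) = (\<Sum>as\<in>strict_partitions N. length (double as))"
    unfolding s_c'_eq_sum_length_double by (simp add: strict_partitions_def)
  also have "\<dots> = (\<Sum>as\<in>strict_partitions N. Max (set as) + 1)"
  proof (rule sum.cong[OF refl])
    fix as assume as: "as \<in> strict_partitions N"
    then obtain a bs where "as = a # bs" using assms by (cases as) (auto simp: strict_partitions_def)
    moreover from this have "Max (set as) = a"
      using as by (intro Max_eqI) (auto simp: strict_partitions_def)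
    ultimately show "length (double as) = Max (set as) + 1"
      using as length_double[of a bs] by (simp add: strict_partitions_def del: double.simps)
  qed
  also have "\<dots> = (\<Sum>A\<in>distinct_parts N. Max A + 1)"
    by (rule sum.reindex_bij_betw[OF set_bij_betw_strict_partitions])
  finally show ?thesis .
qed

lemma s_e_eq_sum_card: "s_e (2 * N) = (\<Sum>A\<in>distinct_parts N. card A)"
proof -
  note dist = distinct_if_strictly_decreasing
  have strict: "sorted_wrt (>) as" if "sorted_wrt (\<ge>) as" "distinct as" for as :: "nat list"
    using that by (induction as) (fastforce simp: le_less)+
  have "bij_betw (map ((*) 2)) (strict_partitions N)
      {lam \<in> partitions (2 * N). distinct lam \<and> (\<forall>x\<in>set lam. even x)}"
  proof (rule bij_betw_byWitness[where f' = "map (\<lambda>x. x div 2)"], goal_cases)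
    case 3
    show ?case
      using dist
      by (auto simp: strict_partitions_def partitions_def sorted_wrt_map distinct_map inj_on_def
          sum_list_const_mult intro!: gr0I elim!: sorted_wrt_mono_rel[rotated])
  next
    case 4
    show ?case
    proof clarify
      fix lam assume lam: "lam \<in> partitions (2 * N)" "distinct lam" "\<forall>x\<in>set lam. even x"
      then have eq: "map ((*) 2) (map (\<lambda>x. x div 2) lam) = lam" by (auto intro!: map_idI)
      \<comment> \<open>Halving is not strictly monotone on all naturals, so strictness and sum are
        read off after doubling, which gives back \<open>lam\<close>.\<close>
      have "sorted_wrt (>) (map ((*) 2) (map (\<lambda>x. x div 2) lam))"
        unfolding eq using strict lam by (simp add: partitions_def)
      moreover have "sum_list (map ((*) 2) (map (\<lambda>x. x div 2) lam)) = 2 * N"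
        unfolding eq using lam by (simp add: partitions_def)
      moreover have "0 \<noteq> x div 2" if "x \<in> set lam" for x
      proof -
        have "even x" "0 < x" using lam that by (auto simp: partitions_def)
        then show ?thesis by (auto elim: evenE)
      qed
      then have "0 \<notin> set (map (\<lambda>x. x div 2) lam)" by (auto simp only: set_map image_iff)
      ultimately show "map (\<lambda>x. x div 2) lam \<in> strict_partitions N"
        by (simp add: strict_partitions_def sorted_wrt_map sum_list_const_mult del: map_map)
    qed
  qed (auto simp: o_def intro!: map_idI)
  then have "s_e (2 * N) = (\<Sum>as\<in>strict_partitions N. length (map ((*) 2) as))"
    unfolding s_e_def by (rule sum.reindex_bij_betw[symmetric])
  also have "\<dots> = (\<Sum>as\<in>strict_partitions N. card (set as))"
    using dist by (intro sum.cong) (simp_all add: strict_partitions_def distinct_card)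
  also have "\<dots> = (\<Sum>A\<in>distinct_parts N. card A)"
    by (rule sum.reindex_bij_betw[OF set_bij_betw_strict_partitions])
  finally show ?thesis .
qed

section \<open>Even partitions with one repeated part as marked sets\<close>

lemma decreasing_eqI:
  fixes xs ys :: "nat list"
  assumes "sorted_wrt (\<ge>) xs" "sorted_wrt (\<ge>) ys" "\<And>z. count_list xs z = count_list ys z"
  shows "xs = ys"
proof -
  have "mset (rev xs) = mset (rev ys)" using assms(3) by (intro multiset_eqI) (simp add: count_mset)
  moreover have "sorted (rev xs)" "sorted (rev ys)" using assms by (simp_all add: sorted_wrt_rev)
  ultimately have "rev xs = rev ys" by (metis properties_for_sort)
  then show ?thesis by simp
qed

definition unmark :: "nat set \<times> nat \<times> nat \<Rightarrow> nat list" where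
  "unmark = (\<lambda>(A, r, m). rev (sort (map ((*) 2) (sorted_list_of_set A @ replicate m r))))"

text \<open>Inverse to \<open>unmark\<close> on triples with \<open>r\<close> outside
  \<open>A\<close> and \<open>1 < m\<close>; there the definite description denotes the unique
  repeated part.\<close>

definition mark :: "nat list \<Rightarrow> nat set \<times> nat \<times> nat" where
  "mark lam = (let x = THE x. count_list lam x > 1
    in ((\<lambda>y. y div 2) ` (set lam - {x}), x div 2, count_list lam x))"

lemma count_list_sort: "count_list (sort xs) z = count_list xs z"
  by (simp flip: count_mset)

lemma count_list_replicate: "count_list (replicate m r) z = (if z = r then m else 0)"
  by (induction m) auto

lemma count_list_distinct: "distinct xs \<Longrightarrow> count_list xs z = (if z \<in> set xs then 1 else 0)"
  by (induction xs) auto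

lemma count_list_unmark:
  assumes "finite A"
  shows "count_list (unmark (A, r, m)) (2 * z) = (if z \<in> A then 1 else 0) + (if z = r then m else 0)"
proof -
  have "count_list (unmark (A, r, m)) (2 * z) = count_list (sorted_list_of_set A @ replicate m r) z"
    unfolding unmark_def prod.case count_list_rev count_list_sort
    by (rule count_list_map_conv) (simp add: inj_def)
  then show ?thesis using assms by (simp add: count_list_distinct count_list_replicate)
qed

lemma sum_list_unmark:
  assumes "finite A"
  shows "sum_list (unmark (A, r, m)) = 2 * (\<Sum>A + m * r)"
proof -
  have "sum_list (unmark (A, r, m)) = sum_list (map ((*) 2) (sorted_list_of_set A @ replicate m r))"
    unfolding unmark_def prod.case sum_list_rev by (metis mset_sort sum_mset_sum_list)
  then show ?thesis
    using assms by (simp add: sum_list_const_mult sum_list_sorted_list_of_set sum_list_replicate)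
qed

text \<open>Via \<open>mark\<close> and \<open>unmark\<close>. The weights agree because the
  repeated part \<open>2 * r\<close> is the smallest part exactly when \<open>r\<close> lies below
  all of \<open>A\<close>.\<close>

lemma sum_even_partitions_eq_sum_marked:
  "(\<Sum>lam\<in>one_repeated_even_partitions (2 * N). repeated_weight lam) =
    (\<Sum>(A, r, m)\<in>{(A, r, m) \<in> marked N. r \<notin> A \<and> 1 < m}. if \<forall>a\<in>A. r < a then 1 else 2)"
proof (rule sum.reindex_bij_witness[where i = unmark and j = mark])
  fix lam assume lam: "lam \<in> one_repeated_even_partitions (2 * N)"
  define x where "x = (THE x. count_list lam x > 1)"
  have ex1: "\<exists>!x. count_list lam x > 1" using lam by (simp add: one_repeated_even_partitions_def)
  have x: "count_list lam x > 1" unfolding x_def using ex1 by (rule theI')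
  have count: "count_list lam z = 1" if "z \<in> set lam" "z \<noteq> x" for z
    using ex1 x that count_list_0_iff[of lam z] by (metis less_one nat_neq_iff)
  have xin: "x \<in> set lam" using x count_list_0_iff[of lam x] by auto
  have ev: "even z" "0 < z" if "z \<in> set lam" for z
    using lam that by (auto simp: one_repeated_even_partitions_def partitions_def)
  have sorted: "sorted_wrt (\<ge>) lam" and sum: "sum_list lam = 2 * N"
    using lam by (auto simp: one_repeated_even_partitions_def partitions_def)
  define A where "A = (\<lambda>y. y div 2) ` (set lam - {x})"
  \<comment> \<open>All parts are even, so halving them loses no information.\<close>
  have mem_A: "z \<in> A \<longleftrightarrow> 2 * z \<in> set lam \<and> 2 * z \<noteq> x" for z
    using ev by (force simp: A_def image_iff elim!: evenE)
  have mark: "mark lam = (A, x div 2, count_list lam x)"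
    by (simp add: mark_def x_def A_def Let_def)
  have x2: "2 * (x div 2) = x" using ev xin by simp
  \<comment> \<open>Both lists decrease, so comparing multiplicities suffices; odd values occur in
    neither.\<close>
  show eq: "unmark (mark lam) = lam"
  proof (rule decreasing_eqI)
    show "sorted_wrt (\<ge>) (unmark (mark lam))" by (simp add: unmark_def mark sorted_wrt_rev)
    fix z
    show "count_list (unmark (mark lam)) z = count_list lam z"
    proof (cases "even z")
      case True
      then obtain w where w: "z = 2 * w" by (elim evenE)
      have "finite A" by (simp add: A_def)
      show ?thesis
        unfolding mark w count_list_unmark[OF \<open>finite A\<close>] mem_A using count x2 by auto
    next
      case False
      then have "z \<notin> set (unmark (mark lam))" "z \<notin> set lam" using ev by (auto simp: unmark_def mark)
      then show ?thesis by (simp add: count_list_0_iff)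
    qed
  qed (rule sorted)
  have "2 * (\<Sum>A + count_list lam x * (x div 2)) = sum_list (unmark (mark lam))"
    unfolding mark by (subst sum_list_unmark) (simp_all add: A_def)
  then have "\<Sum>A + count_list lam x * (x div 2) = N" unfolding eq sum by simp
  moreover have "0 \<notin> A" using ev mem_A by fastforce
  moreover have "x div 2 > 0" using ev(2)[OF xin] x2 by linarith
  moreover have "x div 2 \<notin> A" using x2 mem_A by simp
  ultimately show "mark lam \<in> {(A, r, m) \<in> marked N. r \<notin> A \<and> 1 < m}"
    using x by (simp add: mark marked_def A_def)
  have "(\<forall>a\<in>A. x div 2 < a) \<longleftrightarrow> x = Min (set lam)"
  proof
    assume *: "\<forall>a\<in>A. x div 2 < a"
    have "x \<le> z" if "z \<in> set lam" for z
    proof (cases "z = x")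
      case False
      then have "z div 2 \<in> A" using that by (simp add: A_def)
      then show ?thesis using * by fastforce
    qed simp
    then show "x = Min (set lam)" using xin by (intro Min_eqI[symmetric]) auto
  next
    assume *: "x = Min (set lam)"
    show "\<forall>a\<in>A. x div 2 < a"
    proof
      fix a assume "a \<in> A"
      then have "2 * a \<in> set lam" "2 * a \<noteq> x" using mem_A by auto
      then have "x < 2 * a" using * by (simp add: le_neq_trans)
      then show "x div 2 < a" by linarith
    qed
  qed
  then show "(case mark lam of (A, r, m) \<Rightarrow> if \<forall>a\<in>A. r < a then 1 else 2) = repeated_weight lam"
    unfolding repeated_weight_def mark x_def[symmetric] by simp
next
  fix p assume "p \<in> {(A, r, m) \<in> marked N. r \<notin> A \<and> 1 < m}"
  then obtain A r m where p: "p = (A, r, m)" and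
    A: "finite A" "0 \<notin> A" "0 < r" "1 < m" "\<Sum>A + m * r = N" "r \<notin> A"
    by (auto simp: marked_def)
  define lam where "lam = unmark p"
  have set_lam: "set lam = (*) 2 ` insert r A"
    using A by (auto simp: lam_def unmark_def p)
  have count: "count_list lam (2 * z) = (if z \<in> A then 1 else 0) + (if z = r then m else 0)" for z
    unfolding lam_def p using A(1) by (rule count_list_unmark)
  \<comment> \<open>As \<open>r\<close> is not in \<open>A\<close>, the value \<open>2 * r\<close>
    occurs \<open>m > 1\<close> times and every other value at most once.\<close>
  have gt: "count_list lam z > 1 \<longleftrightarrow> z = 2 * r" for z
  proof (cases "even z")
    case True
    then show ?thesis using A count by (auto elim!: evenE split: if_splits)
  next
    case False
    then have "z \<notin> set lam" using set_lam by auto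
    then show ?thesis using False by (auto simp: count_list_0_iff)
  qed
  then have x: "(THE x. count_list lam x > 1) = 2 * r" by simp
  have "(*) 2 ` insert r A - {2 * r} = (*) 2 ` A" using A by auto
  then have "(\<lambda>y. y div 2) ` (set lam - {2 * r}) = A"
    by (simp only: set_lam) (simp add: image_image)
  then show "mark (unmark p) = p"
    unfolding lam_def[symmetric] mark_def x Let_def using count[of r] A by (simp add: p)
  have "sum_list lam = 2 * N"
    using A by (simp add: lam_def p sum_list_unmark)
  then show "unmark p \<in> one_repeated_even_partitions (2 * N)"
    unfolding lam_def[symmetric] one_repeated_even_partitions_def partitions_def
    using A gt set_lam by (auto simp: lam_def unmark_def p sorted_wrt_rev intro: gr0I)
qed

theorem theorem3p2:
  fixes n :: nat
  assumes "n > 0"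
  shows "int (s_c' n) - 2 * int (s_e n) =
    int (\<Sum>lam\<in>one_repeated_even_partitions n. repeated_weight lam)"
proof (cases "even n")
  case True
  then obtain N where N: "n = 2 * N" "0 < N" using assms by (elim evenE) auto
  show ?thesis
    unfolding N(1) s_c'_eq_sum_Max[OF N(2)] s_e_eq_sum_card sum_even_partitions_eq_sum_marked
      sum_Max_distinct_parts[OF N(2)] by simp
next
  case False
  \<comment> \<open>For odd \<open>n\<close> all three sums are empty: even parts have an even sum,
    and \<open>s_c'\<close> runs over lists with \<open>2 * sum_list as = n\<close>.\<close>
  have "even (sum_list lam)" if "\<forall>x\<in>set lam. even x" for lam :: "nat list"
    using that by (induction lam) auto
  then have "{lam \<in> partitions n. distinct lam \<and> (\<forall>x\<in>set lam. even x)} = {}"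
    "one_repeated_even_partitions n = {}"
    using False by (auto simp: partitions_def one_repeated_even_partitions_def)
  moreover have "{as. sorted_wrt (>) as \<and> 0 \<notin> set as \<and> 2 * sum_list as = n} = {}"
    using False by auto
  ultimately show ?thesis by (simp only: s_c'_eq_sum_length_double s_e_def sum.empty)
qed

end
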